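(* Let $K:(0,\infty)\to\mathbb{R}$ be $C^1$ and strictly decreasing with $\int_0^1 K(r)\,r\,dr<\infty$, and let $D(\Omega)=\int_\Omega\int_\Omega K(|x-y|)\,dx\,dy$. Fix an area $m>0$, and for $q\ge1$ let $\Omega_q\subset\mathbb{R}^2$ be the rhombus (unique up to congruence) of area $m$ such that $q$ is the ratio of the lengths (longer to shorter) of its diagonals. Then $q\mapsto D(\Omega_q)$ is a strictly decreasing function for $q\ge1$.
   Context: $D$ is invariant under rigid motions, so $D(\Omega_q)$ is well defined; the condition $\int_0^1K(r)r\,dr<\infty$ guarantees that $D$ is finite on bounded planar domains. *)

theory Defs
  imports "HOL-Analysis.Analysis"
begin

text \<open>
  The value of \<open>K\<close> at \<open>0\<close> (or at negative arguments) is irrelevant: for each \<open>y\<close>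
  the integrand \<open>K (dist x y)\<close> meets it only at the single point \<open>x = y\<close>.
\<close>
definition interaction :: "(real \<Rightarrow> real) \<Rightarrow> (real^2) set \<Rightarrow> real" where
  "interaction K \<Omega> = (LINT y:\<Omega>|lborel. (LINT x:\<Omega>|lborel. K (dist x y)))"

text \<open>
  A rhombus is an equilateral quadrilateral, with vertices listed in cyclic order.
  In the plane the conditions \<open>a \<noteq> c\<close> and \<open>b \<noteq> d\<close> exclude exactly the degenerate cases:
  \<open>b\<close> and \<open>d\<close> lie on the perpendicular bisector of \<open>a\<close> and \<open>c\<close>, at equal distance from \<open>a\<close>,
  so if they differ they are mirror images of each other off the line through \<open>a\<close> and \<open>c\<close>.
\<close>
definition rhombus_vertices :: "real^2 \<Rightarrow> real^2 \<Rightarrow> real^2 \<Rightarrow> real^2 \<Rightarrow> bool" where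
  "rhombus_vertices a b c d \<longleftrightarrow>
     a \<noteq> c \<and> b \<noteq> d \<and> dist a b = dist b c \<and> dist b c = dist c d \<and> dist c d = dist d a"

text \<open>
  The rhombus is the closed region; its boundary is a null set, so area and
  interaction do not depend on whether it is included.
\<close>
definition rhombus_area_ratio :: "real \<Rightarrow> real \<Rightarrow> (real^2) set \<Rightarrow> bool" where
  "rhombus_area_ratio m q \<Omega> \<longleftrightarrow>
     (\<exists>a b c d. rhombus_vertices a b c d \<and>
        \<Omega> = convex hull {a, b, c, d} \<and>
        measure lborel \<Omega> = m \<and>
        q = max (dist a c) (dist b d) / min (dist a c) (dist b d))"

end

theory Submission
  imports Defs
begin

text \<open>
  Write the rhombus with diagonal ratio \<open>q\<close> as a linear image of the unit square. Since
  \<open>(1 - \<bar>u\<bar>)\<^sub>+ (1 - \<bar>v\<bar>)\<^sub>+\<close> is the covariogram \<open>g\<close> of the square, its interaction is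
  \<open>m\<^sup>2 \<integral> K (N\<^sub>q z) g z dz\<close> with \<open>N\<^sub>q\<^sup>2 = (m / 2) (q x\<^sup>2 + y\<^sup>2 / q)\<close>, where \<open>x = u + v\<close> and
  \<open>y = u - v\<close>. For \<open>p < q\<close> and \<open>E = sqrt (p q)\<close> the area-preserving involution
  \<open>R (x, y) = (y / E, E x)\<close> exchanges \<open>N\<^sub>p\<close> and \<open>N\<^sub>q\<close>. Symmetrising under \<open>R\<close> turns twice the
  difference of the two integrals into
  \<open>\<integral> (K (N\<^sub>p z) - K (N\<^sub>q z)) (g z - g (R z)) dz\<close>. Both factors are nonnegative where
  \<open>\<bar>y\<bar> \<le> E \<bar>x\<bar>\<close> and nonpositive elsewhere, and the product is positive on a nonempty open set.
\<close>

section \<open>Polar coordinates and linear changes of variables\<close>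

text \<open>The disc of radius x has area pi x^2, the integral of 2 pi r over \<open>{0..x}\<close>.
  So both measures agree on the half-lines \<open>{..x}\<close>, which are stable under intersection
  and generate the Borel sets. At negative r the density is 0 because \<open>ennreal\<close>
  truncates there.\<close>

lemma distr_norm_lborel:
  "distr lborel borel (norm :: real^2 \<Rightarrow> real) = density lborel (\<lambda>r. ennreal (2 * pi * r))"
    (is "?M = ?N")
proof (rule measure_eqI_generator_eq[where E = "range atMost" and \<Omega> = UNIV and A = "\<lambda>n. {..real n}"])
  have M: "emeasure ?M {..x} = ennreal (if x < 0 then 0 else pi * x\<^sup>2)" for x
  proof -
    have "emeasure ?M {..x} = emeasure lborel (cball (0::real^2) x)"
      by (subst emeasure_distr) (auto intro!: arg_cong[where f = "emeasure lborel"])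
    then show ?thesis
      by (auto simp: emeasure_cball unit_ball_vol_2)
  qed
  have N: "emeasure ?N {..x} = ennreal (if x < 0 then 0 else pi * x\<^sup>2)" for x
  proof -
    have eq: "emeasure ?N {..x} = (\<integral>\<^sup>+ r. ennreal (2 * pi * r) * indicator {0..x} r \<partial>lborel)"
      by (subst emeasure_density)
        (auto intro!: nn_integral_cong simp: indicator_def ennreal_neg mult_nonneg_nonpos)
    show ?thesis
    proof (cases "x < 0")
      case False
      then have "(\<integral>\<^sup>+ r. ennreal (2 * pi * r) * indicator {0..x} r \<partial>lborel) = pi * x\<^sup>2 - pi * 0\<^sup>2"
        by (intro nn_integral_FTC_Icc) (auto intro!: derivative_eq_intros)
      with False eq show ?thesis by simp
    qed (simp add: eq)
  qed
  show "emeasure ?M X = emeasure ?N X" if "X \<in> range atMost" for X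
    using that M N by auto
  show "emeasure ?M {..real n} \<noteq> \<infinity>" for n
    using M by simp
  show "Int_stable (range (atMost :: real \<Rightarrow> _))"
    by (auto simp: Int_stable_def)
  show "(\<Union>i. {..real i}) = UNIV"
    by (auto simp: real_arch_simple)
qed (auto simp: borel_eq_atMost)

lemma integrable_radial:
  fixes k :: "real \<Rightarrow> real"
  assumes [measurable]: "k \<in> borel_measurable borel"
    and int: "set_integrable lborel {0<..} (\<lambda>r. k r * r)"
  shows "integrable lborel (\<lambda>w::real^2. k (norm w))"
proof -
  have "integrable lborel (\<lambda>r. (2 * pi) * (indicator {0<..} r *\<^sub>R (k r * r)))"
    using int by (intro integrable_mult_right) (simp add: set_integrable_def)
  \<comment> \<open>The maximum makes the density nonnegative as a real function, as
    \<open>integrable_density\<close> requires; \<open>ennreal_max_0\<close> removes it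
    again.\<close>
  also have "(\<lambda>r. (2 * pi) * (indicator {0<..} r *\<^sub>R (k r * r))) = (\<lambda>r. max 0 (2 * pi * r) *\<^sub>R k r)"
    using pi_gt_zero by (auto simp: indicator_def max_def zero_le_mult_iff fun_eq_iff simp del: pi_gt_zero)
  finally have "integrable (density lborel (\<lambda>r. ennreal (max 0 (2 * pi * r)))) k"
    by (subst integrable_density) auto
  then have "integrable (distr lborel borel (norm :: real^2 \<Rightarrow> real)) k"
    by (simp add: distr_norm_lborel ennreal_max_0)
  then show ?thesis
    by (subst (asm) integrable_distr_eq) auto
qed

text \<open>Lebesgue measure is determined by its values on boxes. The preimage of a box is open
  and, as the image of that box under the inverse map, bounded; \<open>measure_linear_image\<close>
  then relates the two volumes.\<close>

lemma lborel_linear: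
  fixes g :: "real^'n::{finite,wellorder} \<Rightarrow> real^'n::{finite,wellorder}"
  assumes lin: "linear g" and det: "det (matrix g) \<noteq> 0"
  shows "lborel = density (distr lborel borel g) (\<lambda>_. ennreal \<bar>det (matrix g)\<bar>)"
proof (rule lborel_eqI)
  have [measurable]: "g \<in> borel_measurable borel"
    using linear_continuous_on[of g UNIV] lin
    by (intro borel_measurable_continuous_onI) (simp add: linear_linear)
  have inj: "inj g"
    using det_nz_iff_inj[OF lin] det by simp
  then obtain h where h: "linear h" "h \<circ> g = id" "g \<circ> h = id"
    using linear_injective_isomorphism[OF lin inj] by (auto simp: fun_eq_iff)
  have gh: "g (h x) = x" and hg: "h (g x) = x" for x
    using h by (simp_all add: fun_eq_iff)
  fix l u :: "real^'n::{finite,wellorder}" assume le: "\<And>b. b \<in> Basis \<Longrightarrow> l \<bullet> b \<le> u \<bullet> b"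
  have eq: "g -` box l u = h ` box l u"
    using gh hg by (auto simp: image_iff) metis
  have "bounded (h ` box l u)"
    using h(1) by (intro bounded_linear_image) (auto simp: linear_linear)
  moreover have op: "open (g -` box l u)"
    using lin by (intro open_vimage) (auto simp: linear_linear linear_continuous_on)
  ultimately have T: "g -` box l u \<in> lmeasurable"
    using eq by (simp add: lmeasurable_open)
  have "g ` (g -` box l u) = box l u"
    by (simp add: eq image_image gh)
  then have "measure lebesgue (box l u) = \<bar>det (matrix g)\<bar> * measure lebesgue (g -` box l u)"
    using measure_linear_image[OF lin T] by simp
  moreover have "emeasure lborel (g -` box l u) = ennreal (measure lebesgue (g -` box l u))"
    using emeasure_eq_ennreal_measure[OF fmeasurableD2[OF T]] op by simp
  ultimately have "ennreal \<bar>det (matrix g)\<bar> * emeasure lborel (g -` box l u) = ennreal (measure lebesgue (box l u))"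
    by (simp add: ennreal_mult)
  then show "emeasure (density (distr lborel borel g) (\<lambda>_. ennreal \<bar>det (matrix g)\<bar>)) (box l u)
      = ennreal (\<Prod>b\<in>Basis. (u - l) \<bullet> b)"
    using le by (simp add: emeasure_density nn_integral_cmult emeasure_distr measure_lborel_box_eq inner_diff_left)
qed simp

lemma
  fixes g :: "real^'n::{finite,wellorder} \<Rightarrow> real^'n::{finite,wellorder}" and f :: "real^'n::{finite,wellorder} \<Rightarrow> real"
  assumes lin: "linear g" and det: "det (matrix g) \<noteq> 0"
    and [measurable]: "f \<in> borel_measurable borel"
  shows lborel_integral_linear: "(LINT x|lborel. f x) = \<bar>det (matrix g)\<bar> * (LINT x|lborel. f (g x))"
    and lborel_integrable_linear_iff: "integrable lborel f \<longleftrightarrow> integrable lborel (\<lambda>x. f (g x))"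
proof -
  have [measurable]: "g \<in> borel_measurable borel"
    using linear_continuous_on[of g UNIV] lin
    by (intro borel_measurable_continuous_onI) (simp add: linear_linear)
  show "(LINT x|lborel. f x) = \<bar>det (matrix g)\<bar> * (LINT x|lborel. f (g x))"
    by (subst lborel_linear[OF lin det]) (simp add: integral_density integral_distr)
  show "integrable lborel f \<longleftrightarrow> integrable lborel (\<lambda>x. f (g x))"
    using det by (subst lborel_linear[OF lin det]) (simp add: integrable_density integrable_distr_eq)
qed

section \<open>The covariogram of the unit square\<close>

text \<open>Substitute x = y + w and exchange the integrals: for fixed w, the integral over y
  measures the part of S that stays in S under translation by w. The set D confines the
  integrability of k to the differences that occur.\<close>

lemma LINT_LINT_diff_eq_covariogram:
  fixes S :: "'a::euclidean_space set" and k :: "'a \<Rightarrow> real"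
  assumes [measurable]: "S \<in> sets borel" "k \<in> borel_measurable borel"
    and fin: "emeasure lborel S < \<infinity>"
    and int: "set_integrable lborel D k" and D: "D \<in> sets borel" "\<And>x y. x \<in> S \<Longrightarrow> y \<in> S \<Longrightarrow> x - y \<in> D"
  shows "(LINT y:S|lborel. LINT x:S|lborel. k (x - y)) =
    (LINT w|lborel. k w * measure lborel {y \<in> S. y + w \<in> S})"
proof -
  note D(1)[measurable]
  define F where "F y w = indicator S y * (indicator S (y + w) * k w)" for y w
  have [measurable]: "case_prod F \<in> borel_measurable (lborel \<Otimes>\<^sub>M lborel)"
    unfolding F_def by measurable
  have S: "integrable lborel (indicator S :: 'a \<Rightarrow> real)"
    using fin by (intro integrable_real_indicator) auto
  have k: "integrable lborel (\<lambda>w. indicator D w * k w)"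
    using int by (simp add: set_integrable_def)
  \<comment> \<open>A product of an integrable function of y and one of w. It dominates F, since F
    can be nonzero only where w is a difference of points of S, hence in D.\<close>
  have "integrable (lborel \<Otimes>\<^sub>M lborel) (\<lambda>p. indicator S (fst p) * (indicator D (snd p) * k (snd p)))"
    using S k
    by (intro lborel_pair.Fubini_integrable)
      (auto simp: norm_mult abs_mult integrable_norm[OF S, simplified] intro!: integrable_mult_left integrable_mult_right)
  then have F: "integrable (lborel \<Otimes>\<^sub>M lborel) (case_prod F)"
  proof (rule Bochner_Integration.integrable_bound)
    have "w \<in> D" if "y \<in> S" "y + w \<in> S" for y w
      using D(2)[OF that(2,1)] by simp
    then have "norm (F y w) \<le> norm (indicator S y * (indicator D w * k w))" for y w
      by (auto simp: F_def indicator_def)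
    then show "AE p in lborel \<Otimes>\<^sub>M lborel. norm (case_prod F p) \<le>
        norm (indicator S (fst p) * (indicator D (snd p) * k (snd p)))"
      by (auto simp: split_beta)
  qed measurable
  have "(LINT x:S|lborel. k (x - y)) = (LINT w|lborel. indicator S (y + w) * k w)" for y
    unfolding set_lebesgue_integral_def
    by (subst lborel_distr_plus[of y, symmetric], subst integral_distr) auto
  then have "(LINT y:S|lborel. LINT x:S|lborel. k (x - y)) = (LINT y|lborel. LINT w|lborel. F y w)"
    by (simp add: F_def set_lebesgue_integral_def)
  also have "\<dots> = (LINT w|lborel. LINT y|lborel. F y w)"
    using lborel_pair.Fubini_integral[OF F] by simp
  also have "(\<lambda>w. LINT y|lborel. F y w) = (\<lambda>w. k w * measure lborel {y \<in> S. y + w \<in> S})"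
  proof
    fix w
    have "(LINT y|lborel. F y w) = (LINT y|lborel. k w * indicator {y \<in> S. y + w \<in> S} y)"
      by (intro Bochner_Integration.integral_cong) (auto simp: F_def indicator_def)
    also have "\<dots> = k w * measure lborel {y \<in> S. y + w \<in> S}"
      by simp
    finally show "(LINT y|lborel. F y w) = k w * measure lborel {y \<in> S. y + w \<in> S}" .
  qed
  finally show ?thesis .
qed

text \<open>The function g of the overview.\<close>

definition tent :: "real^2 \<Rightarrow> real" where
  "tent z = max 0 (1 - \<bar>z $ 1\<bar>) * max 0 (1 - \<bar>z $ 2\<bar>)"

lemma borel_measurable_tent [measurable]: "tent \<in> borel_measurable borel"
  unfolding tent_def by (intro borel_measurable_continuous_onI continuous_intros)

lemma tent_nonneg: "0 \<le> tent z" and tent_le_1: "tent z \<le> 1"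
  unfolding tent_def by (simp, intro mult_le_one) simp_all

text \<open>The square meets its translate in a box with side lengths
  \<open>1 - \<bar>w $ i\<bar>\<close>, or not at all once some \<open>\<bar>w $ i\<bar>\<close>
  exceeds 1.\<close>

lemma measure_unit_square_Int_translate:
  "measure lborel {y \<in> cbox 0 1. y + w \<in> cbox 0 (1::real^2)} = tent w"
proof -
  have eq: "{y \<in> cbox 0 1. y + w \<in> cbox 0 (1::real^2)} =
      cbox (\<chi> i. max 0 (- w $ i)) (\<chi> i. min 1 (1 - w $ i))" (is "_ = cbox ?l ?u")
    by (auto simp: mem_box_cart forall_2)
  show ?thesis
  proof (cases "\<bar>w $ 1\<bar> \<le> 1 \<and> \<bar>w $ 2\<bar> \<le> 1")
    case True
    then have "cbox ?l ?u \<noteq> {}"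
      by (auto simp: interval_eq_empty_cart exhaust_2 forall_2)
    then show ?thesis
      using True unfolding eq content_cbox_cart[OF \<open>cbox ?l ?u \<noteq> {}\<close>]
      by (auto simp: UNIV_2 tent_def max_def min_def)
  next
    case False
    then obtain i where "\<bar>w $ i\<bar> > 1"
      by (auto simp: not_le)
    then have "?u $ i < ?l $ i"
      by (simp add: min_def max_def abs_if split: if_splits)
    then have "cbox ?l ?u = {}"
      unfolding interval_eq_empty_cart by blast
    then show ?thesis
      using False unfolding eq by (auto simp: tent_def max_def)
  qed
qed

section \<open>The covariogram inequality under the swap\<close>

text \<open>Here h is \<open>tent\<close> in the coordinates x = u + v, y = u - v. Sign symmetry
  reduces the claim to x, y \<ge> 0. There, with y = E b and b \<le> x, either the left side
  vanishes or all truncations but one absolute value disappear, leaving a polynomial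
  inequality.\<close>

lemma tent_swap_le:
  fixes x y E :: real
  assumes "1 \<le> E" "\<bar>y\<bar> \<le> E * \<bar>x\<bar>"
  defines "h \<equiv> \<lambda>x y. max 0 (1 - \<bar>x + y\<bar> / 2) * max 0 (1 - \<bar>x - y\<bar> / 2)"
  shows "h (y / E) (E * x) \<le> h x y"
proof -
  have abs: "h \<bar>x\<bar> \<bar>y\<bar> = h x y" for x y
  proof -
    \<comment> \<open>Taking absolute values either keeps or exchanges
      \<open>\<bar>x + y\<bar>\<close> and \<open>\<bar>x - y\<bar>\<close>, and h is symmetric in
      these two.\<close>
    consider "\<bar>x\<bar> + \<bar>y\<bar> = \<bar>x + y\<bar>" "\<bar>\<bar>x\<bar> - \<bar>y\<bar>\<bar> = \<bar>x - y\<bar>"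
      | "\<bar>x\<bar> + \<bar>y\<bar> = \<bar>x - y\<bar>" "\<bar>\<bar>x\<bar> - \<bar>y\<bar>\<bar> = \<bar>x + y\<bar>"
      by (cases "x \<ge> 0"; cases "y \<ge> 0"; force)
    then show ?thesis
      by cases (simp_all add: h_def mult.commute)
  qed
  have h_nonneg: "0 \<le> h x y" for x y
    by (simp add: h_def)
  have pos: "h (y / E) (E * x) \<le> h x y" if "0 \<le> x" "0 \<le> y" "y \<le> E * x" for x y
  proof -
    define b where "b = y / E"
    have y: "y = E * b" and b: "0 \<le> b" "b \<le> x"
      using assms(1) that by (auto simp: b_def field_simps)
    have bx: "b \<le> E * x"
      using b assms(1) mult_mono[of 1 E b x] by simp
    show ?thesis
    proof (cases "E * x + b < 2")
      case False
      then have "h (y / E) (E * x) = 0"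
        using b assms(1) that by (simp add: h_def b_def[symmetric])
      then show ?thesis using h_nonneg by simp
    next
      case True
      have "0 \<le> (E - 1) * (x - b)"
        using assms(1) b by simp
      then have sum_le: "x + y \<le> E * x + b"
        by (simp add: y algebra_simps)
      have "h (y / E) (E * x) = (1 - (b + E * x) / 2) * (1 - (E * x - b) / 2)"
        using True b bx that by (simp add: h_def b_def[symmetric] max_def)
      moreover have "h x y = (1 - (x + y) / 2) * (1 - \<bar>x - y\<bar> / 2)"
        using True sum_le that by (simp add: h_def max_def)
      moreover have "(1 - (b + E * x) / 2) * (1 - (E * x - b) / 2) \<le> (1 - (x + y) / 2) * (1 - \<bar>x - y\<bar> / 2)"
      proof (cases "y \<le> x")
        case yx: True
        \<comment> \<open>Right side minus left side is (E - 1) (x - (E + 1) (x^2 + b^2) / 4). Twice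
          this is the sum of the two nonnegative terms that follow.\<close>
        have "0 \<le> (E - 1) * x * (2 - (E * x + b))"
          using assms(1) True that by simp
        moreover have "0 \<le> (E - 1) * ((E - 1) * (x * x - b * b) / 2 + b * (x - b))"
          using assms(1) b mult_mono[of b x b x] by (intro mult_nonneg_nonneg add_nonneg_nonneg) auto
        ultimately show ?thesis
          using yx by (simp add: y field_simps)
      next
        case False
        \<comment> \<open>Now the difference is (x - b) (4 E - (E^2 + 1) (x + b)) / 4. Its second
          factor is twice the first term below plus the second term.\<close>
        have "0 \<le> E * (2 - (E * x + b))"
          using assms(1) True by simp
        moreover have "0 \<le> (E - 1) * (2 * x + (E - 1) * (x - b))"
          using assms(1) b that by simp
        ultimately have "0 \<le> 4 * E - (E * E + 1) * (x + b)"
          by (simp add: algebra_simps)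
        then have "0 \<le> (x - b) * (4 * E - (E * E + 1) * (x + b))"
          using b by simp
        then show ?thesis
          using False by (simp add: y field_simps)
      qed
      ultimately show ?thesis by simp
    qed
  qed
  have "h (y / E) (E * x) = h (\<bar>y\<bar> / E) (E * \<bar>x\<bar>)"
    using abs[of "y / E" "E * x"] assms(1) by (simp add: abs_mult)
  also have "\<dots> \<le> h \<bar>x\<bar> \<bar>y\<bar>"
    using pos assms(2) by simp
  finally show ?thesis
    by (simp only: abs)
qed

section \<open>Rhombi are parallelograms\<close>

text \<open>In dimension two, nonzero orthogonal g and k form a basis.\<close>

lemma orthogonal_two_imp_zero:
  fixes g h k :: "real^2"
  assumes "h \<bullet> g = 0" "h \<bullet> k = 0" "g \<bullet> k = 0" "g \<noteq> 0" "k \<noteq> 0"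
  shows "h = 0"
proof -
  have "(h$1*g$1+h$2*g$2) = 0" "h$1*k$1+h$2*k$2 = 0" "g$1*k$1+g$2*k$2 = 0"
    using assms by (auto simp: inner_vec_def sum_2)
  moreover have "g$1 * g$1 + g$2 * g$2 \<noteq> 0" "k$1 * k$1 + k$2 * k$2 \<noteq> 0"
    using assms(4,5) by (auto simp: vec_eq_iff forall_2 add_nonneg_eq_0_iff)
  ultimately have "h$1 = 0 \<and> h$2 = 0"
    by algebra
  then show ?thesis
    by (simp add: vec_eq_iff forall_2)
qed

text \<open>The equal sides make the diagonals g and e - f orthogonal, and make the defect g - (e +
  f) orthogonal to both of them; so the defect is zero.\<close>

lemma rhombus_vertices_imp_parallelogram:
  assumes "rhombus_vertices a b c d"
  shows "c = b + d - a"
proof -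
  define e f g where "e = b - a" and "f = d - a" and "g = c - a"
  have ne: "g \<noteq> 0" "e - f \<noteq> 0"
    using assms by (auto simp: rhombus_vertices_def e_def f_def g_def)
  have "norm e = norm f" "norm (g - e) = norm e" "norm (g - f) = norm f"
    using assms by (auto simp: rhombus_vertices_def e_def f_def g_def dist_norm norm_minus_commute)
  then have "e \<bullet> e = f \<bullet> f" "(g - e) \<bullet> (g - e) = e \<bullet> e" "(g - f) \<bullet> (g - f) = f \<bullet> f"
    by (simp_all add: dot_square_norm)
  then have "(g - (e + f)) \<bullet> g = 0" "(g - (e + f)) \<bullet> (e - f) = 0" "g \<bullet> (e - f) = 0"
    by (simp_all add: inner_diff_left inner_diff_right inner_add_left inner_add_right inner_commute)
  then have "g - (e + f) = 0"
    using orthogonal_two_imp_zero ne by blast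
  then show ?thesis
    by (simp add: e_def f_def g_def algebra_simps)
qed

section \<open>Parallelograms as affine images of the unit square\<close>

definition parallelogram_map :: "real^2 \<Rightarrow> real^2 \<Rightarrow> real^2 \<Rightarrow> real^2" where
  "parallelogram_map e f z = z $ 1 *\<^sub>R e + z $ 2 *\<^sub>R f"

lemma linear_parallelogram_map: "linear (parallelogram_map e f)"
  unfolding parallelogram_map_def by (intro linearI) (simp_all add: scaleR_add_left scaleR_add_right)

lemma det_matrix_parallelogram_map: "det (matrix (parallelogram_map e f)) = e $ 1 * f $ 2 - f $ 1 * e $ 2"
  by (simp add: det_2 matrix_def parallelogram_map_def axis_def)

text \<open>Lagrange's identity: the squared determinant is the Gram determinant of e and f. It ties
  the area of a rhombus to its diagonals.\<close>

lemma det_matrix_parallelogram_map_sq: "(det (matrix (parallelogram_map e f)))\<^sup>2 = (norm e)\<^sup>2 * (norm f)\<^sup>2 - (e \<bullet> f)\<^sup>2"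
proof -
  have "e \<bullet> f = e $ 1 * f $ 1 + e $ 2 * f $ 2" for e f :: "real^2"
    by (simp add: inner_vec_def sum_2)
  then show ?thesis
    unfolding power2_norm_eq_inner det_matrix_parallelogram_map by (simp add: power2_eq_square algebra_simps)
qed

text \<open>The unit square is the hull of its four corners, and affine maps commute with convex
  hulls.\<close>

lemma convex_hull_parallelogram:
  "convex hull {a, a + e, a + e + f, a + f} = (\<lambda>z. a + parallelogram_map e f z) ` cbox 0 1"
proof -
  let ?V = "{x :: real^2. \<forall>i. x $ i = 0 \<or> x $ i = 1}"
  have "(\<lambda>z. a + parallelogram_map e f z) ` ?V = {a, a + e, a + e + f, a + f}" (is "?l = ?r")
  proof
    show "?l \<subseteq> ?r"
      by (auto simp: parallelogram_map_def forall_2)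
    have "a + parallelogram_map e f (vector [s, t]) \<in> ?l" if "s \<in> {0, 1}" "t \<in> {0, 1}" for s t
      using that by (intro imageI) (auto simp: forall_2)
    from this[of 0 0] this[of 0 1] this[of 1 0] this[of 1 1]
    show "?r \<subseteq> ?l"
      by (simp add: parallelogram_map_def add.assoc)
  qed
  moreover have "convex hull ((\<lambda>z. a + parallelogram_map e f z) ` ?V) = (\<lambda>z. a + parallelogram_map e f z) ` (convex hull ?V)"
  proof -
    have eq: "(\<lambda>z. a + parallelogram_map e f z) ` T = (+) a ` parallelogram_map e f ` T" for T
      by (simp add: image_image)
    show ?thesis
      unfolding eq convex_hull_translation convex_hull_linear_image[OF linear_parallelogram_map] ..
  qed
  moreover have "cbox 0 1 = convex hull ?V"
    unfolding Cart_1 unit_interval_convex_hull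
    by (rule arg_cong[where f = "\<lambda>S. convex hull S"]) (simp add: Basis_vec_def inner_axis)
  ultimately show ?thesis
    by simp
qed

text \<open>Each of the two integrations over the parallelogram contributes a factor
  \<open>\<bar>det\<bar>\<close> when pulled back to the square; the remaining double integral
  depends on differences only and becomes an integral against the covariogram.\<close>

lemma
  fixes k :: "real \<Rightarrow> real" and a e f :: "real^2"
  assumes [measurable]: "k \<in> borel_measurable borel"
    and int: "\<And>R. set_integrable lborel {0<..R} (\<lambda>r. k r * r)"
    and det: "det (matrix (parallelogram_map e f)) \<noteq> 0"
  shows integrable_parallelogram_map_tent: "integrable lborel (\<lambda>z. k (norm (parallelogram_map e f z)) * tent z)" (is ?int)
    and interaction_parallelogram: "interaction k ((\<lambda>z. a + parallelogram_map e f z) ` cbox 0 1) =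
      (det (matrix (parallelogram_map e f)))\<^sup>2 * (LINT z|lborel. k (norm (parallelogram_map e f z)) * tent z)" (is ?eq)
proof -
  let ?d = "det (matrix (parallelogram_map e f))" and ?S = "cbox 0 1 :: (real^2) set"
  have [measurable]: "parallelogram_map e f \<in> borel_measurable borel"
    using linear_continuous_on[of "parallelogram_map e f" UNIV] linear_parallelogram_map
    by (intro borel_measurable_continuous_onI) (simp add: linear_linear)
  \<comment> \<open>A bound for the norm on the square \<open>cbox (-1) 1\<close>, which contains
    the support of \<open>tent\<close> and all differences of points of the unit square.\<close>
  define R where "R = norm e + norm f"
  have R: "norm (parallelogram_map e f z) \<le> R" if "\<bar>z $ 1\<bar> \<le> 1" "\<bar>z $ 2\<bar> \<le> 1" for z
    unfolding parallelogram_map_def R_def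
    by (rule order.trans[OF norm_triangle_ineq]) (intro add_mono; simp add: mult_left_le_one_le that)
  \<comment> \<open>Integrability of k r * r is given on bounded intervals, so k is cut off at R,
    where nothing relevant is lost; the radial lemma then applies on the whole plane.\<close>
  define k0 where "k0 r = indicator {..R} r * k r" for r
  have [measurable]: "k0 \<in> borel_measurable borel"
    unfolding k0_def by measurable
  have "(\<lambda>r. indicator {0<..R} r *\<^sub>R (k r * r)) = (\<lambda>r. indicator {0<..} r *\<^sub>R (k0 r * r))"
    by (auto simp: k0_def indicator_def)
  then have "set_integrable lborel {0<..} (\<lambda>r. k0 r * r)"
    using int[of R] by (simp add: set_integrable_def)
  then have "integrable lborel (\<lambda>w::real^2. k0 (norm w))"
    by (intro integrable_radial) auto
  then have k0: "integrable lborel (\<lambda>z. k0 (norm (parallelogram_map e f z)))"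
    by (subst (asm) lborel_integrable_linear_iff[OF linear_parallelogram_map det]) auto
  show ?int
  proof (rule Bochner_Integration.integrable_bound[OF k0])
    have "norm (k (norm (parallelogram_map e f z)) * tent z) \<le> norm (k0 (norm (parallelogram_map e f z)))" for z
    proof (cases "\<bar>z $ 1\<bar> \<le> 1 \<and> \<bar>z $ 2\<bar> \<le> 1")
      case True
      then show ?thesis
        using R[of z] tent_nonneg[of z] tent_le_1[of z]
        by (simp add: k0_def abs_mult mult_right_le_one_le)
    next
      case False
      then have "tent z = 0" by (auto simp: tent_def)
      then show ?thesis by simp
    qed
    then show "AE z in lborel. norm (k (norm (parallelogram_map e f z)) * tent z) \<le> norm (k0 (norm (parallelogram_map e f z)))"
      by simp
  qed measurable
  define \<Omega> where "\<Omega> = (\<lambda>z. a + parallelogram_map e f z) ` ?S"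
  have inj: "inj (parallelogram_map e f)"
    using det_nz_iff_inj[OF linear_parallelogram_map] det by simp
  have "compact \<Omega>"
    unfolding \<Omega>_def parallelogram_map_def by (intro compact_continuous_image continuous_intros compact_cbox)
  then have [measurable]: "\<Omega> \<in> sets borel"
    by (simp add: borel_closed compact_imp_closed)
  have ind: "indicator \<Omega> (a + parallelogram_map e f z) = (indicator ?S z :: real)" for z
    using inj by (auto simp: \<Omega>_def indicator_def inj_eq)
  have change: "(LINT x:\<Omega>|lborel. \<phi> x) = \<bar>?d\<bar> * (LINT z:?S|lborel. \<phi> (a + parallelogram_map e f z))"
    if [measurable]: "\<phi> \<in> borel_measurable borel" for \<phi> :: "real^2 \<Rightarrow> real"
  proof -
    have "(LINT x:\<Omega>|lborel. \<phi> x) = (LINT x|lborel. indicator \<Omega> (a + x) * \<phi> (a + x))"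
      unfolding set_lebesgue_integral_def
      by (subst lborel_distr_plus[of a, symmetric], subst integral_distr) auto
    also have "\<dots> = \<bar>?d\<bar> * (LINT z|lborel. indicator \<Omega> (a + parallelogram_map e f z) * \<phi> (a + parallelogram_map e f z))"
      by (rule lborel_integral_linear[OF linear_parallelogram_map det]) measurable
    finally show ?thesis
      by (simp add: ind set_lebesgue_integral_def)
  qed
  have diff: "dist (a + parallelogram_map e f x) (a + parallelogram_map e f y) = norm (parallelogram_map e f (x - y))" for x y
    by (simp add: dist_norm linear_diff[OF linear_parallelogram_map])
  have "interaction k \<Omega> = \<bar>?d\<bar> * (LINT y:?S|lborel. LINT x:\<Omega>|lborel. k (dist x (a + parallelogram_map e f y)))"
    unfolding interaction_def set_lebesgue_integral_def[of _ \<Omega>]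
    by (subst change[symmetric]) (auto simp: set_lebesgue_integral_def)
  also have "\<dots> = ?d\<^sup>2 * (LINT y:?S|lborel. LINT x:?S|lborel. k (norm (parallelogram_map e f (x - y))))"
  proof -
    have "(LINT x:\<Omega>|lborel. k (dist x (a + parallelogram_map e f y))) =
        \<bar>?d\<bar> * (LINT x:?S|lborel. k (norm (parallelogram_map e f (x - y))))" for y
      by (subst change) (simp_all add: diff del: dist_add_cancel)
    then have "\<bar>?d\<bar> * (LINT y:?S|lborel. LINT x:\<Omega>|lborel. k (dist x (a + parallelogram_map e f y))) =
        \<bar>?d\<bar> * (\<bar>?d\<bar> * (LINT y:?S|lborel. LINT x:?S|lborel. k (norm (parallelogram_map e f (x - y)))))"
      by (simp only: set_integral_mult_right)
    then show ?thesis
      by (simp add: power2_eq_square flip: mult.assoc)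
  qed
  also have "(LINT y:?S|lborel. LINT x:?S|lborel. k (norm (parallelogram_map e f (x - y)))) =
      (LINT w|lborel. k (norm (parallelogram_map e f w)) * tent w)"
  proof (subst LINT_LINT_diff_eq_covariogram[where D = "cbox (-1) 1"])
    have "norm (parallelogram_map e f z) \<le> R" if "z \<in> cbox (-1) 1" for z
      using that by (intro R) (auto simp: mem_box_cart forall_2)
    then show "set_integrable lborel (cbox (-1) 1) (\<lambda>z. k (norm (parallelogram_map e f z)))"
      unfolding set_integrable_def
      by (intro Bochner_Integration.integrable_bound[OF k0]) (auto simp: k0_def indicator_def)
    show "x - y \<in> cbox (-1) 1" if "x \<in> ?S" "y \<in> ?S" for x y
      using that by (auto simp: mem_box_cart forall_2)
  qed (simp_all add: measure_unit_square_Int_translate emeasure_lborel_cbox_finite[unfolded infinity_ennreal_def])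
  finally show ?eq
    by (simp add: \<Omega>_def)
qed

section \<open>The interaction in terms of area and diagonal ratio\<close>

text \<open>This is \<open>N\<^sub>q\<close>: the Euclidean norm pulled back to the square when the
  diagonals e + f and e - f are orthogonal with squared lengths 2 m q and 2 m / q.\<close>

definition rhombus_norm :: "real \<Rightarrow> real \<Rightarrow> real^2 \<Rightarrow> real" where
  "rhombus_norm m q z = sqrt (m / 2 * (q * (z $ 1 + z $ 2)\<^sup>2 + (z $ 1 - z $ 2)\<^sup>2 / q))"

lemma measure_parallelogram:
  "measure lborel ((\<lambda>z. a + parallelogram_map e f z) ` cbox 0 1) = \<bar>det (matrix (parallelogram_map e f))\<bar>"
proof -
  have "compact ((\<lambda>z. a + parallelogram_map e f z) ` cbox 0 1)"
    unfolding parallelogram_map_def by (intro compact_continuous_image continuous_intros compact_cbox)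
  then have "(\<lambda>z. a + parallelogram_map e f z) ` cbox 0 1 \<in> sets lborel"
    by (simp add: borel_closed compact_imp_closed)
  then have "measure lborel ((\<lambda>z. a + parallelogram_map e f z) ` cbox 0 1) =
      measure lebesgue ((\<lambda>z. a + parallelogram_map e f z) ` cbox 0 1)"
    by (rule measure_completion[symmetric])
  also have "\<dots> = measure lebesgue ((+) a ` parallelogram_map e f ` cbox 0 1)"
    by (simp only: image_image)
  also have "\<dots> = \<bar>det (matrix (parallelogram_map e f))\<bar> * measure lebesgue (cbox 0 (1::real^2))"
    by (simp only: measure_translation) (rule measure_linear_image[OF linear_parallelogram_map lmeasurable_cbox])
  also have "measure lebesgue (cbox 0 (1::real^2)) = 1"
    by (simp add: content_cbox_if_cart interval_eq_empty_cart)
  finally show ?thesis by simp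
qed

text \<open>The area fixes the product of the diagonals and q their quotient, hence both lengths. As
  the diagonals are orthogonal, this fixes the pulled back norm. Here q may lie below 1, so either
  diagonal can come first.\<close>

lemma parallelogram_of_rhombus:
  assumes V: "rhombus_vertices a b c d" and \<Omega>: "\<Omega> = convex hull {a, b, c, d}"
    and m: "measure lborel \<Omega> = m" and q: "q = dist a c / dist b d"
  obtains a e f where "\<Omega> = (\<lambda>z. a + parallelogram_map e f z) ` cbox 0 1"
    "\<bar>det (matrix (parallelogram_map e f))\<bar> = m" "norm \<circ> parallelogram_map e f = rhombus_norm m q"
proof
  define e f where "e = b - a" and "f = d - a"
  have c: "c = a + e + f" "b = a + e" "d = a + f"
    using rhombus_vertices_imp_parallelogram[OF V] by (simp_all add: e_def f_def)
  show eq: "\<Omega> = (\<lambda>z. a + parallelogram_map e f z) ` cbox 0 1"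
    unfolding \<Omega> c by (rule convex_hull_parallelogram)
  show det: "\<bar>det (matrix (parallelogram_map e f))\<bar> = m"
    using m unfolding eq measure_parallelogram .
  define A B where "A = dist a c" and "B = dist b d"
  have AB: "A = norm (e + f)" "B = norm (e - f)"
    unfolding A_def B_def dist_commute[of a] by (simp_all add: c dist_norm add.assoc)
  have pos: "A > 0" "B > 0"
    using V by (auto simp: A_def B_def rhombus_vertices_def)
  have "norm e = norm f"
    using V by (auto simp: rhombus_vertices_def e_def f_def dist_norm norm_minus_commute)
  then have ef: "e \<bullet> e = f \<bullet> f"
    by (simp add: dot_square_norm)
  have AB2: "A\<^sup>2 = 2 * (e \<bullet> e) + 2 * (e \<bullet> f)" "B\<^sup>2 = 2 * (e \<bullet> e) - 2 * (e \<bullet> f)"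
    unfolding AB power2_norm_eq_inner
    by (simp_all add: inner_add_left inner_add_right inner_diff_left inner_diff_right ef inner_commute)
  have "m\<^sup>2 = (e \<bullet> e) * (e \<bullet> e) - (e \<bullet> f)\<^sup>2"
    using det_matrix_parallelogram_map_sq[of e f] by (simp add: det[symmetric] power2_norm_eq_inner ef)
  \<comment> \<open>The product of the two expressions for \<open>A\<^sup>2\<close> and
    \<open>B\<^sup>2\<close> is four times the Gram determinant.\<close>
  then have "(A * B)\<^sup>2 = (2 * m)\<^sup>2"
    unfolding power_mult_distrib AB2 by (simp add: power2_eq_square algebra_simps)
  moreover have "A * B \<ge> 0" "2 * m \<ge> 0"
    using pos det by auto
  ultimately have ABm: "A * B = 2 * m"
    by (rule power2_eq_imp_eq)
  have "(norm (parallelogram_map e f z))\<^sup>2 = m / 2 * (q * (z $ 1 + z $ 2)\<^sup>2 + (z $ 1 - z $ 2)\<^sup>2 / q)" for z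
  proof -
    have "A\<^sup>2 = 2 * m * q" "B\<^sup>2 = 2 * m / q"
      using pos by (simp_all add: ABm[symmetric] q A_def[symmetric] B_def[symmetric] power2_eq_square)
    \<comment> \<open>Half the sum and half the difference of the coordinates of z are the
      coefficients along the two diagonals; the mixed term drops out because e and f have equal
      length.\<close>
    moreover have "(norm (parallelogram_map e f z))\<^sup>2 = ((z $ 1 + z $ 2)\<^sup>2 * A\<^sup>2 + (z $ 1 - z $ 2)\<^sup>2 * B\<^sup>2) / 4"
      unfolding AB2 power2_norm_eq_inner parallelogram_map_def
      by (simp add: inner_add_left inner_add_right ef inner_commute) (simp add: power2_eq_square algebra_simps)
    ultimately show ?thesis
      by (simp add: distrib_left add_divide_distrib)
  qed
  then show "norm \<circ> parallelogram_map e f = rhombus_norm m q"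
    unfolding rhombus_norm_def by (metis comp_apply ext norm_ge_zero real_sqrt_unique)
qed

text \<open>Since the right side involves only m and q, all rhombi with these data have the same
  interaction, whatever their position.\<close>

lemma
  fixes k :: "real \<Rightarrow> real"
  assumes k: "k \<in> borel_measurable borel" "\<And>R. set_integrable lborel {0<..R} (\<lambda>r. k r * r)"
    and m: "m > 0" and rh: "rhombus_area_ratio m q \<Omega>"
  shows integrable_rhombus: "integrable lborel (\<lambda>z. k (rhombus_norm m q z) * tent z)"
    and interaction_rhombus: "interaction k \<Omega> = m\<^sup>2 * (LINT z|lborel. k (rhombus_norm m q z) * tent z)"
proof -
  obtain a b c d where V: "rhombus_vertices a b c d" "\<Omega> = convex hull {a, b, c, d}"
    "measure lborel \<Omega> = m" and q: "q = max (dist a c) (dist b d) / min (dist a c) (dist b d)"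
    using rh unfolding rhombus_area_ratio_def by blast
  obtain a e f where *: "\<Omega> = (\<lambda>z. a + parallelogram_map e f z) ` cbox 0 1"
    "\<bar>det (matrix (parallelogram_map e f))\<bar> = m" "norm \<circ> parallelogram_map e f = rhombus_norm m q"
  proof (cases "dist b d \<le> dist a c")
    case True
    then have "q = dist a c / dist b d"
      using q by simp
    then show ?thesis
      using parallelogram_of_rhombus[OF V] that by metis
  next
    case False
    \<comment> \<open>Shifting the labels cyclically exchanges the diagonals, so that the longer one
      comes first.\<close>
    have "rhombus_vertices b c d a"
      using V(1) by (auto simp: rhombus_vertices_def dist_commute)
    moreover have "\<Omega> = convex hull {b, c, d, a}"
      unfolding V(2) by (rule arg_cong[where f = "\<lambda>S. convex hull S"]) auto
    moreover have "q = dist b d / dist c a"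
      using False q by (simp add: dist_commute)
    ultimately show ?thesis
      using parallelogram_of_rhombus V(3) that by metis
  qed
  have norm: "norm (parallelogram_map e f z) = rhombus_norm m q z" for z
    using *(3) by (metis comp_apply)
  have det: "det (matrix (parallelogram_map e f)) \<noteq> 0" "(det (matrix (parallelogram_map e f)))\<^sup>2 = m\<^sup>2"
    using *(2) m by auto
  show "integrable lborel (\<lambda>z. k (rhombus_norm m q z) * tent z)"
    using integrable_parallelogram_map_tent[OF k det(1)] by (simp add: norm)
  show "interaction k \<Omega> = m\<^sup>2 * (LINT z|lborel. k (rhombus_norm m q z) * tent z)"
    using interaction_parallelogram[OF k det(1), of a] by (simp add: norm *(1) det(2))
qed

section \<open>The involution exchanging two diagonal ratios\<close>

text \<open>This is \<open>(x, y) \<mapsto> (y / E, E * x)\<close> in the coordinates \<open>x = z $ 1 + z $ 2\<close>, \<open>y = z $ 1 - z $ 2\<close>.\<close>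
definition hyperbolic_swap :: "real \<Rightarrow> real^2 \<Rightarrow> real^2" where
  "hyperbolic_swap E = parallelogram_map
     (vector [(E + 1 / E) / 2, (1 / E - E) / 2]) (vector [(E - 1 / E) / 2, (- 1 / E - E) / 2])"

lemma hyperbolic_swap_sum: "hyperbolic_swap E z $ 1 + hyperbolic_swap E z $ 2 = (z $ 1 - z $ 2) / E"
  and hyperbolic_swap_diff: "hyperbolic_swap E z $ 1 - hyperbolic_swap E z $ 2 = E * (z $ 1 + z $ 2)"
proof -
  \<comment> \<open>With c in place of 1 / E, the simplification produces no side condition E
    \<noteq> 0.\<close>
  define c where "c = 1 / E"
  have nth: "hyperbolic_swap E z $ 1 = (z $ 1 * (E + c) + z $ 2 * (E - c)) / 2"
    "hyperbolic_swap E z $ 2 = (z $ 1 * (c - E) + z $ 2 * (- c - E)) / 2"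
    by (simp_all add: hyperbolic_swap_def parallelogram_map_def c_def add_divide_distrib)
  have "hyperbolic_swap E z $ 1 + hyperbolic_swap E z $ 2 = (z $ 1 - z $ 2) * c"
    unfolding nth by (simp add: field_simps)
  then show "hyperbolic_swap E z $ 1 + hyperbolic_swap E z $ 2 = (z $ 1 - z $ 2) / E"
    by (simp add: c_def)
  show "hyperbolic_swap E z $ 1 - hyperbolic_swap E z $ 2 = E * (z $ 1 + z $ 2)"
    unfolding nth by (simp add: field_simps)
qed

lemma vec2_eqI: "x $ 1 + x $ 2 = y $ 1 + y $ 2 \<Longrightarrow> x $ 1 - x $ 2 = y $ 1 - y $ 2 \<Longrightarrow> x = y"
  for x y :: "real^2"
  unfolding vec_eq_iff forall_2 by linarith

lemma hyperbolic_swap_involution: "E \<noteq> 0 \<Longrightarrow> hyperbolic_swap E (hyperbolic_swap E z) = z"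
  by (rule vec2_eqI) (simp_all add: hyperbolic_swap_sum hyperbolic_swap_diff)

lemma det_hyperbolic_swap: "E \<noteq> 0 \<Longrightarrow> det (matrix (hyperbolic_swap E)) = - 1"
  unfolding hyperbolic_swap_def det_matrix_parallelogram_map by (simp add: field_simps)

lemma linear_hyperbolic_swap: "linear (hyperbolic_swap E)"
  by (simp add: hyperbolic_swap_def linear_parallelogram_map)

text \<open>Since \<open>E\<^sup>2 = p * q\<close>, the coefficients \<open>p / E\<^sup>2\<close>
  and \<open>E\<^sup>2 / p\<close> created by the swap are 1 / q and q.\<close>

lemma rhombus_norm_hyperbolic_swap:
  assumes "p > 0" "q > 0" "E\<^sup>2 = p * q"
  shows "rhombus_norm m p (hyperbolic_swap E z) = rhombus_norm m q z"
proof -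
  have "p * (z $ 1 - z $ 2)\<^sup>2 / E\<^sup>2 + E\<^sup>2 * (z $ 1 + z $ 2)\<^sup>2 / p = q * (z $ 1 + z $ 2)\<^sup>2 + (z $ 1 - z $ 2)\<^sup>2 / q"
    using assms by simp
  then show ?thesis
    by (simp add: rhombus_norm_def hyperbolic_swap_sum hyperbolic_swap_diff power_divide power_mult_distrib)
qed

lemma tent_hyperbolic_swap_le:
  assumes "1 \<le> E" "\<bar>z $ 1 - z $ 2\<bar> \<le> E * \<bar>z $ 1 + z $ 2\<bar>"
  shows "tent (hyperbolic_swap E z) \<le> tent z"
proof -
  have tent: "tent w = max 0 (1 - \<bar>(w $ 1 + w $ 2) + (w $ 1 - w $ 2)\<bar> / 2) *
      max 0 (1 - \<bar>(w $ 1 + w $ 2) - (w $ 1 - w $ 2)\<bar> / 2)" for w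
    by (simp add: tent_def abs_mult)
  show ?thesis
    unfolding tent[of "hyperbolic_swap E z"] tent[of z] hyperbolic_swap_sum hyperbolic_swap_diff
    by (rule tent_swap_le[OF assms])
qed

text \<open>The difference of the squared norms is a positive multiple of (E x)^2 - y^2. Positivity
  of the smaller norm is recorded because the kernel is monotone only on positive arguments.\<close>

lemma rhombus_norm_less:
  assumes "m > 0" "0 < p" "p < q" "E > 0" "E\<^sup>2 = p * q"
  shows "\<bar>z $ 1 - z $ 2\<bar> < E * \<bar>z $ 1 + z $ 2\<bar> \<Longrightarrow> 0 < rhombus_norm m p z \<and> rhombus_norm m p z < rhombus_norm m q z"
    and "\<bar>z $ 1 - z $ 2\<bar> = E * \<bar>z $ 1 + z $ 2\<bar> \<Longrightarrow> rhombus_norm m p z = rhombus_norm m q z"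
    and "\<bar>z $ 1 - z $ 2\<bar> > E * \<bar>z $ 1 + z $ 2\<bar> \<Longrightarrow> 0 < rhombus_norm m q z \<and> rhombus_norm m q z < rhombus_norm m p z"
proof -
  define x y where "x = z $ 1 + z $ 2" and "y = z $ 1 - z $ 2"
  have N: "rhombus_norm m r z = sqrt (m / 2 * (r * x\<^sup>2 + y\<^sup>2 / r))" for r
    by (simp add: rhombus_norm_def x_def y_def)
  have diff: "(q * x\<^sup>2 + y\<^sup>2 / q) - (p * x\<^sup>2 + y\<^sup>2 / p) = (q - p) / (p * q) * ((E * x)\<^sup>2 - y\<^sup>2)"
    using assms by (simp add: power_mult_distrib field_simps)
  have c: "(q - p) / (p * q) > 0"
    using assms by simp
  have E: "E * \<bar>x\<bar> = \<bar>E * x\<bar>"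
    using assms by (simp add: abs_mult)
  show "0 < rhombus_norm m p z \<and> rhombus_norm m p z < rhombus_norm m q z" if "\<bar>z $ 1 - z $ 2\<bar> < E * \<bar>z $ 1 + z $ 2\<bar>"
  proof -
    have lt: "y\<^sup>2 < (E * x)\<^sup>2"
      using that abs_le_square_iff[of "E * x" y] unfolding x_def[symmetric] y_def[symmetric] E by linarith
    then have "x \<noteq> 0" by auto
    then have "0 < p * x\<^sup>2 + y\<^sup>2 / p"
      using assms by (intro add_pos_nonneg) auto
    moreover have "0 < (q - p) / (p * q) * ((E * x)\<^sup>2 - y\<^sup>2)"
      using lt c by (intro mult_pos_pos) auto
    ultimately show ?thesis
      using assms(1) diff by (simp add: N)
  qed
  show "rhombus_norm m p z = rhombus_norm m q z" if "\<bar>z $ 1 - z $ 2\<bar> = E * \<bar>z $ 1 + z $ 2\<bar>"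
  proof -
    have "y\<^sup>2 = (E * x)\<^sup>2"
      using that by (simp add: x_def[symmetric] y_def[symmetric] E abs_eq_iff power2_eq_iff)
    then show ?thesis
      using diff by (simp add: N)
  qed
  show "0 < rhombus_norm m q z \<and> rhombus_norm m q z < rhombus_norm m p z" if "\<bar>z $ 1 - z $ 2\<bar> > E * \<bar>z $ 1 + z $ 2\<bar>"
  proof -
    have lt: "(E * x)\<^sup>2 < y\<^sup>2"
      using that abs_le_square_iff[of y "E * x"] unfolding x_def[symmetric] y_def[symmetric] E by linarith
    then have "y \<noteq> 0" by auto
    then have "0 < q * x\<^sup>2 + y\<^sup>2 / q"
      using assms by (intro add_nonneg_pos) auto
    moreover have "(q - p) / (p * q) * ((E * x)\<^sup>2 - y\<^sup>2) < 0"
      using lt c by (intro mult_pos_neg) auto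
    ultimately show ?thesis
      using assms(1) diff by (simp add: N)
  qed
qed

section \<open>Symmetrisation and strictness\<close>

lemma LINT_rhombus_norm_tent_less:
  fixes k :: "real \<Rightarrow> real"
  assumes [measurable]: "k \<in> borel_measurable borel" and anti: "strict_antimono_on {0<..} k"
    and m: "m > 0" and pq: "1 \<le> p" "p < q"
    and int: "\<And>r. r \<in> {p, q} \<Longrightarrow> integrable lborel (\<lambda>z. k (rhombus_norm m r z) * tent z)"
  shows "(LINT z|lborel. k (rhombus_norm m q z) * tent z) < (LINT z|lborel. k (rhombus_norm m p z) * tent z)"
proof -
  define E where "E = sqrt (p * q)"
  have "1 < p * q"
    using pq mult_right_mono[of 1 p q] by linarith
  then have E: "E > 1" "E\<^sup>2 = p * q"
    using pq by (simp_all add: E_def)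
  define F where "F r z = k (rhombus_norm m r z)" for r z
  have [measurable]: "rhombus_norm m r \<in> borel_measurable borel" for r
    unfolding rhombus_norm_def
    by (cases "r = 0") (auto intro!: borel_measurable_continuous_onI continuous_intros)
  have [measurable]: "F r \<in> borel_measurable borel" for r
    unfolding F_def by measurable
  have F_swap: "F p (hyperbolic_swap E z) = F q z" "F q (hyperbolic_swap E z) = F p z" for z
    using rhombus_norm_hyperbolic_swap[of p q E m z] rhombus_norm_hyperbolic_swap[of q p E m z] pq E
    by (simp_all add: F_def mult.commute)
  have I: "integrable lborel (\<lambda>z. F r z * tent z)" if "r \<in> {p, q}" for r
    using int[OF that] by (simp add: F_def)
  have change: "integrable lborel (\<lambda>z. g (hyperbolic_swap E z)) \<longleftrightarrow> integrable lborel g"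
      "(LINT z|lborel. g (hyperbolic_swap E z)) = (LINT z|lborel. g z)"
    if [measurable]: "g \<in> borel_measurable borel" for g :: "real^2 \<Rightarrow> real"
    using lborel_integrable_linear_iff[OF linear_hyperbolic_swap, of E g]
      lborel_integral_linear[OF linear_hyperbolic_swap, of E g]
      det_hyperbolic_swap[of E] E(1) by simp_all
  \<comment> \<open>The swap has determinant -1 and exchanges F p and F q, so the integrals with the
    swapped \<open>tent\<close> are the original ones with p and q exchanged.\<close>
  have J: "integrable lborel (\<lambda>z. F q z * tent (hyperbolic_swap E z))"
    "integrable lborel (\<lambda>z. F p z * tent (hyperbolic_swap E z))"
    "(LINT z|lborel. F q z * tent (hyperbolic_swap E z)) = (LINT z|lborel. F p z * tent z)"
    "(LINT z|lborel. F p z * tent (hyperbolic_swap E z)) = (LINT z|lborel. F q z * tent z)"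
    using change[of "\<lambda>z. F p z * tent z"] change[of "\<lambda>z. F q z * tent z"] I by (simp_all add: F_swap)
  define G where "G z = (F p z - F q z) * (tent z - tent (hyperbolic_swap E z))" for z
  have G_eq: "G z = F p z * tent z - F p z * tent (hyperbolic_swap E z) -
      (F q z * tent z - F q z * tent (hyperbolic_swap E z))" for z
    by (simp add: G_def algebra_simps)
  have G_int: "integrable lborel G"
    unfolding G_eq[abs_def] using I J by (intro Bochner_Integration.integrable_diff) auto
  have G_LINT: "(LINT z|lborel. G z) = 2 * ((LINT z|lborel. F p z * tent z) - (LINT z|lborel. F q z * tent z))"
    unfolding G_eq using I J by simp
  have lt: "F q z < F p z" if "\<bar>z $ 1 - z $ 2\<bar> < E * \<bar>z $ 1 + z $ 2\<bar>" for z
    using monotone_onD[OF anti, of "rhombus_norm m p z" "rhombus_norm m q z"]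
      rhombus_norm_less(1)[OF m _ _ _ E(2) that] pq E(1) by (simp add: F_def)
  have G_nonneg: "0 \<le> G z" for z
  proof (cases "\<bar>z $ 1 - z $ 2\<bar>" "E * \<bar>z $ 1 + z $ 2\<bar>" rule: linorder_cases)
    case less
    then show ?thesis
      using lt[of z] tent_hyperbolic_swap_le[of E z] E(1) by (simp add: G_def)
  next
    case equal
    then show ?thesis
      using rhombus_norm_less(2)[OF m _ _ _ E(2) equal] pq E(1) by (simp add: G_def F_def)
  next
    case greater
    \<comment> \<open>The swap carries this region into the one where
      \<open>tent_hyperbolic_swap_le\<close> applies; being an involution, it returns the reversed
      inequality at z.\<close>
    have "tent (hyperbolic_swap E (hyperbolic_swap E z)) \<le> tent (hyperbolic_swap E z)"
      using greater E(1) by (intro tent_hyperbolic_swap_le)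
        (simp_all add: hyperbolic_swap_sum hyperbolic_swap_diff abs_mult)
    then have "tent z \<le> tent (hyperbolic_swap E z)"
      using E(1) by (simp add: hyperbolic_swap_involution)
    moreover have "F p z \<le> F q z"
      using monotone_onD[OF anti, of "rhombus_norm m q z" "rhombus_norm m p z"]
        rhombus_norm_less(3)[OF m _ _ _ E(2) greater] pq E(1) by (simp add: F_def)
    ultimately show ?thesis
      by (simp add: G_def mult_nonpos_nonpos)
  qed
  \<comment> \<open>On U the function \<open>tent\<close> is positive and F p exceeds F q. The last
    condition pushes the first coordinate of the swapped point beyond 1 in absolute value, so
    \<open>tent\<close> vanishes there.\<close>
  define U where "U = {z :: real^2. \<bar>z $ 1\<bar> < 1 \<and> \<bar>z $ 2\<bar> < 1 \<and>
    \<bar>z $ 1 - z $ 2\<bar> < E * \<bar>z $ 1 + z $ 2\<bar> \<and> 2 < \<bar>(z $ 1 - z $ 2) / E + E * (z $ 1 + z $ 2)\<bar>}"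
  have G_pos: "0 < G z" if "z \<in> U" for z
  proof -
    have "\<bar>hyperbolic_swap E z $ 1\<bar> > 1"
      using that hyperbolic_swap_sum[of E z] hyperbolic_swap_diff[of E z]
      by (simp add: U_def abs_mult flip: hyperbolic_swap_sum hyperbolic_swap_diff)
    then have "tent (hyperbolic_swap E z) = 0"
      by (simp add: tent_def)
    moreover have "0 < tent z"
      using that by (simp add: tent_def U_def)
    ultimately show ?thesis
      using lt[of z] that by (simp add: G_def U_def)
  qed
  have "open U"
    unfolding U_def by (intro open_Collect_conj open_Collect_less continuous_intros) (use E in auto)
  \<comment> \<open>The diagonal point (t, t) has y = 0, so it lies in U as soon as t < 1 < E t; the
    midpoint of 1 / E and 1 satisfies this.\<close>
  define t where "t = (1 + 1 / E) / 2"
  have "0 < t" "t < 1" "E * (t + t) = E + 1"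
    using E(1) by (simp_all add: t_def add_pos_pos distrib_left)
  then have "(\<chi> i. t) \<in> U"
    using E(1) by (simp add: U_def)
  then have "\<not> negligible U"
    using \<open>open U\<close> open_not_negligible by blast
  have "(LINT z|lborel. G z) \<noteq> 0"
  proof
    assume "(LINT z|lborel. G z) = 0"
    then have "AE z in lborel. G z = 0"
      using integral_nonneg_eq_0_iff_AE[OF G_int] G_nonneg by simp
    then have "AE z in lborel. z \<notin> U"
      by eventually_elim (use G_pos in force)
    then have "U \<in> null_sets lborel"
      using \<open>open U\<close> by (subst (asm) AE_iff_null_sets[symmetric]) auto
    then show False
      using \<open>\<not> negligible U\<close> by (simp add: negligible_iff_null_sets null_sets_completionI)
  qed
  moreover have "0 \<le> (LINT z|lborel. G z)"
    using G_nonneg by simp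
  ultimately show ?thesis
    unfolding G_LINT F_def by simp
qed

section \<open>Strict decrease of the interaction in the diagonal ratio\<close>

theorem theorem1p8:
  fixes K :: "real \<Rightarrow> real" and m :: real and \<Omega> :: "real \<Rightarrow> (real^2) set"
  assumes "K C1_differentiable_on {0<..}"
    and "strict_antimono_on {0<..} K"
    and "set_integrable lborel {0<..<1} (\<lambda>r. K r * r)"
    and "m > 0"
    and "\<And>q. q \<ge> 1 \<Longrightarrow> rhombus_area_ratio m q (\<Omega> q)"
  shows "strict_antimono_on {1..} (\<lambda>q. interaction K (\<Omega> q))"
proof (rule monotone_onI)
  fix p q :: real assume pq: "p \<in> {1..}" "q \<in> {1..}" "p < q"
  \<comment> \<open>K may be non-measurable on negative arguments, so it is made constant off
    \<open>{0<..}\<close>. The constant K 0 keeps k equal to K at every distance, including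
    0.\<close>
  define k where "k r = (if r \<in> {0<..} then K r else K 0)" for r
  have cont: "continuous_on {0<..} K"
    by (rule C1_differentiable_imp_continuous_on[OF assms(1)])
  have k_meas: "k \<in> borel_measurable borel"
    unfolding k_def using cont by (intro borel_measurable_continuous_on_if) auto
  have k_anti: "strict_antimono_on {0<..} k"
    using assms(2) by (simp add: monotone_on_def k_def)
  have k_int: "set_integrable lborel {0<..R} (\<lambda>r. k r * r)" for R
  proof -
    \<comment> \<open>The hypothesis covers radii below 1; from 1 to R, continuity on a compact
      interval suffices.\<close>
    have "set_integrable lborel {1..R} (\<lambda>r. K r * r)"
      unfolding set_integrable_def
      by (rule borel_integrable_compact)
        (auto intro!: continuous_intros continuous_on_subset[OF cont])
    then have "set_integrable lborel ({0<..<1} \<union> {1..R}) (\<lambda>r. K r * r)"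
      using assms(3) by (intro set_integrable_Un) auto
    then have "set_integrable lborel {0<..R} (\<lambda>r. K r * r)"
      by (rule set_integrable_subset) auto
    also have "set_integrable lborel {0<..R} (\<lambda>r. K r * r) \<longleftrightarrow> set_integrable lborel {0<..R} (\<lambda>r. k r * r)"
      by (intro set_integrable_cong) (auto simp: k_def)
    finally show ?thesis .
  qed
  have k_dist: "K (dist x y) = k (dist x y)" for x y :: "real^2"
    by (auto simp: k_def)
  have eq: "interaction K (\<Omega> r) = m\<^sup>2 * (LINT z|lborel. k (rhombus_norm m r z) * tent z)" if "r \<ge> 1" for r
    using interaction_rhombus[OF k_meas k_int assms(4) assms(5)[OF that]]
    by (simp add: interaction_def k_dist)
  have "(LINT z|lborel. k (rhombus_norm m q z) * tent z) < (LINT z|lborel. k (rhombus_norm m p z) * tent z)"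
    using pq by (intro LINT_rhombus_norm_tent_less[OF k_meas k_anti assms(4)])
      (auto intro!: integrable_rhombus[OF k_meas k_int assms(4) assms(5)])
  then show "interaction K (\<Omega> q) < interaction K (\<Omega> p)"
    using pq assms(4) by (simp add: eq)
qed

end
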